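(* For every positive integer $k$, the limit $\lim_{n\to\infty}\frac{\tilde{r}(P_k,C_n)}{n}$ exists (as a finite real number).
   Context: For finite graphs $G$ and $H$, the online Ramsey game is played by Builder and Painter on the infinite complete graph $K_{\mathbb{N}}$ with vertex set $\mathbb{N}$. In each round Builder chooses an edge of $K_{\mathbb{N}}$ and Painter immediately and irrevocably colors it red or blue. (Builder may re-choose an already chosen edge, which keeps its color; this gives Builder no advantage.) The online Ramsey number $\tilde{r}(G,H)$ is the smallest integer $t$ for which Builder has a strategy that guarantees, regardless of Painter's choices, a red copy of $G$ or a blue copy of $H$ (as a not necessarily induced subgraph) within at most $t$ rounds. $P_n$ denotes the path on $n$ vertices and $C_n$ ($n\ge 3$) the cycle on $n$ vertices. *)

theory Defs
  imports "HOL-Analysis.Analysis" "HOL-Library.Ramsey"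
begin

type_synonym 'a graph = "'a set \<times> 'a set set"

definition finite_graph :: "'a graph \<Rightarrow> bool" where
  "finite_graph G \<longleftrightarrow> finite (fst G) \<and> (\<forall>e\<in>snd G. e \<subseteq> fst G \<and> card e = 2)"

definition path_graph :: "nat \<Rightarrow> nat graph" where
  "path_graph n = ({..<n}, {{i, Suc i} |i. Suc i < n})"

text \<open>The cycle is meant for \<open>n \<ge> 3\<close> only; for smaller \<open>n\<close> the value is of no significance.\<close>

definition cycle_graph :: "nat \<Rightarrow> nat graph" where
  "cycle_graph n = ({..<n}, {{i, Suc i mod n} |i. i < n})"

lemma finite_graph_path: "finite_graph (path_graph n)"
  by (auto simp: finite_graph_def path_graph_def)

lemma finite_graph_cycle:
  assumes "n \<ge> 3" shows "finite_graph (cycle_graph n)"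
proof -
  have "i \<noteq> Suc i mod n" if "i < n" for i
    using that assms by (cases "Suc i = n") auto
  then show ?thesis
    using assms by (auto simp: finite_graph_def cycle_graph_def)
qed

text \<open>A not necessarily induced copy of \<open>G\<close> whose edges all lie in \<open>F\<close>. Every natural number is a
  vertex of the board, so the isolated vertices of \<open>G\<close> only need to be mapped injectively.\<close>

definition contains_copy :: "nat set set \<Rightarrow> 'a graph \<Rightarrow> bool" where
  "contains_copy F G \<longleftrightarrow>
     (\<exists>f :: 'a \<Rightarrow> nat. inj_on f (fst G) \<and> (\<forall>e\<in>snd G. f ` e \<in> F))"

datatype colour = Red | Blue

text \<open>A history lists the edges chosen so far, each with its colour, in chronological order.\<close>

type_synonym history = "(nat set \<times> colour) list"
type_synonym builder = "history \<Rightarrow> nat set"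
type_synonym painter = "history \<Rightarrow> nat set \<Rightarrow> colour"

definition legal_builder :: "builder \<Rightarrow> bool" where
  "legal_builder \<sigma> \<longleftrightarrow> (\<forall>h. card (\<sigma> h) = 2)"

text \<open>The history after a number of rounds. Painter's answer only counts if the edge is new;
  an edge that is chosen again keeps its colour.\<close>

primrec play :: "builder \<Rightarrow> painter \<Rightarrow> nat \<Rightarrow> history" where
  "play \<sigma> \<pi> 0 = []"
| "play \<sigma> \<pi> (Suc t) =
     (let h = play \<sigma> \<pi> t; e = \<sigma> h
      in h @ [(e, case map_of h e of None \<Rightarrow> \<pi> h e | Some c \<Rightarrow> c)])"

definition edges_of_colour :: "colour \<Rightarrow> history \<Rightarrow> nat set set" where
  "edges_of_colour c h = {e. (e, c) \<in> set h}"

definition builder_can_win :: "'a graph \<Rightarrow> 'b graph \<Rightarrow> nat \<Rightarrow> bool" where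
  "builder_can_win G H t \<longleftrightarrow>
     (\<exists>\<sigma>. legal_builder \<sigma> \<and>
       (\<forall>\<pi>. \<exists>s\<le>t. contains_copy (edges_of_colour Red (play \<sigma> \<pi> s)) G \<or>
                   contains_copy (edges_of_colour Blue (play \<sigma> \<pi> s)) H))"

definition online_ramsey :: "'a graph \<Rightarrow> 'b graph \<Rightarrow> nat" where
  "online_ramsey G H = (LEAST t. builder_can_win G H t)"

lemma contains_copy_complete:
  assumes G: "finite_graph G" and R: "finite R" "card R = card (fst G)"
    and F: "\<And>x y. x \<in> R \<Longrightarrow> y \<in> R \<Longrightarrow> x \<noteq> y \<Longrightarrow> {x, y} \<in> F"
  shows "contains_copy F G"
proof -
  have "finite (fst G)"
    using G by (simp add: finite_graph_def)
  then obtain f where f: "bij_betw f (fst G) R"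
    using R finite_same_card_bij by metis
  have "f ` e \<in> F" if e: "e \<in> snd G" for e
  proof -
    obtain x y where xy: "e = {x, y}" "x \<noteq> y"
      using G e by (auto simp: finite_graph_def card_2_iff)
    moreover have "x \<in> fst G" "y \<in> fst G"
      using G e xy by (auto simp: finite_graph_def)
    ultimately have "f x \<in> R" "f y \<in> R" "f x \<noteq> f y"
      using f by (auto simp: bij_betw_def inj_on_def)
    then show ?thesis
      using F xy by simp
  qed
  then show ?thesis
    using f unfolding contains_copy_def bij_betw_def by blast
qed

text \<open>The set minimised in \<^const>\<open>online_ramsey\<close> is nonempty, by Ramsey's theorem.\<close>

lemma builder_can_win_exists:
  assumes G: "finite_graph G" and H: "finite_graph H"
  shows "\<exists>t. builder_can_win G H t"
proof -
  obtain N where N: "\<And>(V :: nat set) E. finite V \<Longrightarrow> card V \<ge> N \<Longrightarrow>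
      \<exists>R\<subseteq>V. card R = card (fst G) \<and> clique R E \<or> card R = card (fst H) \<and> indep R E"
    using ramsey2[of "card (fst G)" "card (fst H)"] by blast
  define K where "K = {e. e \<subseteq> {..<N} \<and> card e = 2}"
  have "finite K"
    by (auto simp: K_def)
  then obtain es where es: "set es = K"
    using finite_list by blast
  define \<sigma> :: builder where "\<sigma> h = (if length h < length es then es ! length h else {0, 1})" for h
  have legal: "legal_builder \<sigma>"
    using es nth_mem[of _ es] by (auto simp: legal_builder_def \<sigma>_def K_def)
  have chosen: "t \<le> length es \<Longrightarrow> map fst (play \<sigma> \<pi> t) = take t es" for \<pi> t
  proof (induction t)
    case (Suc t)
    then have IH: "map fst (play \<sigma> \<pi> t) = take t es"
      by simp
    then have "length (play \<sigma> \<pi> t) = t"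
      using Suc.prems by (auto dest: arg_cong[where f = length])
    then have "\<sigma> (play \<sigma> \<pi> t) = es ! t"
      using Suc.prems \<sigma>_def[of "play \<sigma> \<pi> t"] by simp
    then show ?case
      using IH Suc.prems by (simp add: Let_def take_Suc_conv_app_nth)
  qed simp
  have "contains_copy (edges_of_colour Red (play \<sigma> \<pi> (length es))) G \<or>
        contains_copy (edges_of_colour Blue (play \<sigma> \<pi> (length es))) H" for \<pi>
  proof -
    let ?h = "play \<sigma> \<pi> (length es)"
    let ?R = "edges_of_colour Red ?h" and ?B = "edges_of_colour Blue ?h"
    have K: "fst ` set ?h = K"
      using arg_cong[OF chosen[of "length es" \<pi>], of set] es by simp
    have coloured: "e \<in> ?R \<or> e \<in> ?B" if "e \<in> K" for e
    proof -
      have "e \<in> fst ` set ?h"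
        unfolding K by (rule that)
      then obtain c where "(e, c) \<in> set ?h"
        by (elim imageE) (metis prod.collapse)
      then show ?thesis
        unfolding edges_of_colour_def by (cases c) blast+
    qed
    obtain R where R: "R \<subseteq> {..<N}"
      "card R = card (fst G) \<and> clique R ?R \<or> card R = card (fst H) \<and> indep R ?R"
      using N[of "{..<N}" ?R] by auto
    have inK: "{x, y} \<in> K" if "x \<in> R" "y \<in> R" "x \<noteq> y" for x y
      using that R(1) by (auto simp: K_def)
    have "finite R"
      using R(1) finite_subset by blast
    show ?thesis
    proof (cases "card R = card (fst G) \<and> clique R ?R")
      case True
      have "contains_copy ?R G"
        by (rule contains_copy_complete[OF G \<open>finite R\<close>]) (use True in \<open>auto simp: clique_def\<close>)
      then show ?thesis ..
    next
      case False
      then have "card R = card (fst H)" "indep R ?R"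
        using R(2) by blast+
      moreover from this have "{x, y} \<in> ?B" if "x \<in> R" "y \<in> R" "x \<noteq> y" for x y
        using that coloured[OF inK] unfolding indep_def by blast
      ultimately have "contains_copy ?B H"
        by (intro contains_copy_complete[OF H \<open>finite R\<close>])
      then show ?thesis ..
    qed
  qed
  then show ?thesis
    using legal unfolding builder_can_win_def by blast
qed

end

theory Submission
  imports Defs
begin

text \<open>
  Write \<open>r n\<close> for the online Ramsey number of \<open>P\<^sub>k\<close> versus \<open>C\<^sub>n\<close>. For fixed \<open>k\<close> there is a constant \<open>C\<close>
  with \<open>r (m + n) \<le> r m + r n + C\<close> for all large \<open>m\<close> and \<open>n\<close>, so \<open>r n + C\<close> is subadditive and Fekete's
  lemma (\<open>fekete\<close>) gives convergence of \<open>(r n + C) / n\<close>, hence of \<open>r n / n\<close>.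

  The inequality comes from merging two cycles at bounded cost. As long as no red \<open>P\<^sub>k\<close> has appeared,
  Builder can force a blue \<open>C\<^sub>m\<close>, then a blue \<open>C\<^sub>n\<close> on fresh vertices. Deleting a vertex from each
  leaves two blue paths. Builder now takes a large but bounded set \<open>W\<close> of fresh vertices and chooses
  all pairs inside \<open>T\<close>, the union of \<open>W\<close> and the first and last \<open>k\<close> vertices of both paths. The size
  of \<open>T\<close>, and so the number of these rounds, depends on \<open>k\<close> only.

  Two facts then apply if there is still no red \<open>P\<^sub>k\<close>. By Ramsey's theorem \<open>W\<close> contains a blue
  clique \<open>Q\<close> with \<open>4 k + 2\<close> vertices. And between any two disjoint subsets of \<open>T\<close> with at least \<open>k\<close>
  vertices some edge is blue, because a complete bipartite red graph would contain \<open>P\<^sub>k\<close>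
  (\<open>blue_edge_between\<close>). Such blue edges connect the end of the first path to the start of the second,
  the end of the second to \<open>Q\<close>, and \<open>Q\<close> to the start of the first. The result is a blue
  cycle that loses at most \<open>4 k\<close> vertices of the two paths. Its part in \<open>Q\<close> can have any
  number of vertices from \<open>2\<close> to \<open>4 k + 2\<close>, so the length can be adjusted to be exactly \<open>m + n\<close>
  (\<open>merge_paths\<close>).

  To combine strategies, Builder's ability to win is expressed by a predicate on positions, that is,
  on the sets of red and blue edges (\<open>builder_can_win_iff_forces\<close>). For this predicate, playing one
  game after another and playing a game on other vertices are simple inductions.
\<close>

section \<open>The game as a recursion on positions\<close>

text \<open>From the position with red edges \<open>R\<close> and blue edges \<open>B\<close>, Builder can reach a position satisfying
  \<open>P\<close> within the given number of rounds. The implications in \<open>move\<close> express that an edge chosen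
  earlier keeps its colour: of the two outcomes, only the one that leaves the position unchanged
  must then be good.\<close>

inductive forces :: "(nat set set \<Rightarrow> nat set set \<Rightarrow> bool) \<Rightarrow> nat \<Rightarrow> nat set set \<Rightarrow> nat set set \<Rightarrow> bool"
  for P where
  reached: "P R B \<Longrightarrow> forces P t R B"
| move: "card e = 2 \<Longrightarrow> (e \<notin> B \<longrightarrow> forces P t (insert e R) B) \<Longrightarrow>
    (e \<notin> R \<longrightarrow> forces P t R (insert e B)) \<Longrightarrow> forces P (Suc t) R B"

lemma forces_0_iff: "forces P 0 R B \<longleftrightarrow> P R B"
  by (auto elim: forces.cases intro: reached)

abbreviation red :: "history \<Rightarrow> nat set set" where
  "red \<equiv> edges_of_colour Red"

abbreviation blue :: "history \<Rightarrow> nat set set" where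
  "blue \<equiv> edges_of_colour Blue"

lemma edges_of_colour_Nil [simp]: "edges_of_colour c [] = {}"
  by (simp add: edges_of_colour_def)

lemma edges_of_colour_snoc [simp]:
  "edges_of_colour c (h @ [(e, d)]) =
    (if c = d then insert e (edges_of_colour c h) else edges_of_colour c h)"
  by (auto simp: edges_of_colour_def)

lemma length_play [simp]: "length (play \<sigma> \<pi> t) = t"
  by (induction t) (auto simp: Let_def)

text \<open>This replaces the lookup in the history by the two colour sets, which determine its result because
  no edge ever gets two colours (\<open>red_blue_disjoint\<close>).\<close>

lemma play_Suc_cases:
  fixes \<sigma> \<pi> t
  defines "h \<equiv> play \<sigma> \<pi> t"
  obtains c where "play \<sigma> \<pi> (Suc t) = h @ [(\<sigma> h, c)]"
    "\<sigma> h \<in> red h \<union> blue h \<Longrightarrow> \<sigma> h \<in> edges_of_colour c h"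
    "\<sigma> h \<notin> red h \<union> blue h \<Longrightarrow> c = \<pi> h (\<sigma> h)"
proof -
  define c where "c = (case map_of h (\<sigma> h) of None \<Rightarrow> \<pi> h (\<sigma> h) | Some c \<Rightarrow> c)"
  show thesis
  proof (rule that[of c])
    show "play \<sigma> \<pi> (Suc t) = h @ [(\<sigma> h, c)]"
      by (simp add: c_def Let_def flip: h_def)
    show "\<sigma> h \<in> edges_of_colour c h" if "\<sigma> h \<in> red h \<union> blue h"
    proof (cases "map_of h (\<sigma> h)")
      case None
      then show ?thesis using that by (force simp: map_of_eq_None_iff edges_of_colour_def)
    next
      case (Some d)
      then show ?thesis using map_of_SomeD[OF Some] by (simp add: c_def edges_of_colour_def)
    qed
    show "c = \<pi> h (\<sigma> h)" if "\<sigma> h \<notin> red h \<union> blue h"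
    proof (cases "map_of h (\<sigma> h)")
      case None
      then show ?thesis by (simp add: c_def)
    next
      case (Some d)
      then show ?thesis
        using map_of_SomeD[OF Some] that by (cases d) (auto simp: edges_of_colour_def)
    qed
  qed
qed

lemma red_blue_disjoint: "red (play \<sigma> \<pi> t) \<inter> blue (play \<sigma> \<pi> t) = {}"
proof (induction t)
  case (Suc t)
  obtain c where c: "play \<sigma> \<pi> (Suc t) = play \<sigma> \<pi> t @ [(\<sigma> (play \<sigma> \<pi> t), c)]"
    "\<sigma> (play \<sigma> \<pi> t) \<in> red (play \<sigma> \<pi> t) \<union> blue (play \<sigma> \<pi> t) \<Longrightarrow>
      \<sigma> (play \<sigma> \<pi> t) \<in> edges_of_colour c (play \<sigma> \<pi> t)"
    using play_Suc_cases[of \<sigma> \<pi> t] by blast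
  show ?case
    using Suc c(2) unfolding c(1) by (cases c) auto
qed simp

text \<open>If \<open>P\<close> cannot be forced, then every choice of Builder has an answer after which \<open>P\<close> still cannot
  be forced in the remaining rounds. Painter giving such answers defeats every strategy.\<close>

lemma forces_if_strategy:
  assumes "legal_builder \<sigma>"
    and wins: "\<And>\<pi>. \<exists>s\<le>t. P (red (play \<sigma> \<pi> s)) (blue (play \<sigma> \<pi> s))"
  shows "forces P t {} {}"
proof (rule ccontr)
  assume lost: "\<not> forces P t {} {}"
  define \<pi> :: painter where
    "\<pi> h e = (if forces P (t - Suc (length h)) (insert e (red h)) (blue h) then Blue else Red)" for h e
  have survives: "s \<le> t \<Longrightarrow> \<not> forces P (t - s) (red (play \<sigma> \<pi> s)) (blue (play \<sigma> \<pi> s))" for s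
  proof (induction s)
    case 0
    then show ?case using lost by simp
  next
    case (Suc s)
    define h e where "h = play \<sigma> \<pi> s" and "e = \<sigma> h"
    obtain c where c: "play \<sigma> \<pi> (Suc s) = h @ [(e, c)]"
      "e \<in> red h \<union> blue h \<Longrightarrow> e \<in> edges_of_colour c h"
      "e \<notin> red h \<union> blue h \<Longrightarrow> c = \<pi> h e"
      unfolding h_def e_def using play_Suc_cases[of \<sigma> \<pi> s] by blast
    have "t - s = Suc (t - Suc s)"
      using Suc.prems by simp
    then have "\<not> forces P (Suc (t - Suc s)) (red h) (blue h)"
      using Suc by (simp add: h_def)
    moreover have "card e = 2"
      using assms(1) by (simp add: legal_builder_def e_def)
    ultimately have bad: "(e \<notin> blue h \<and> \<not> forces P (t - Suc s) (insert e (red h)) (blue h)) \<or>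
        (e \<notin> red h \<and> \<not> forces P (t - Suc s) (red h) (insert e (blue h)))"
      using move by metis
    have disj: "red h \<inter> blue h = {}"
      unfolding h_def by (rule red_blue_disjoint)
    have len: "length h = s"
      by (simp add: h_def)
    show ?case
    proof (cases "e \<in> red h \<union> blue h")
      case True
      then show ?thesis
        using bad c(2) disj unfolding c(1) by (cases c) (auto simp: insert_absorb)
    next
      case False
      then show ?thesis
        using bad c(3) len unfolding c(1) by (auto simp: \<pi>_def split: if_splits)
    qed
  qed
  obtain s where "s \<le> t" "P (red (play \<sigma> \<pi> s)) (blue (play \<sigma> \<pi> s))"
    using wins by blast
  then show False
    using survives reached by blast
qed

text \<open>Builder always makes a move that keeps \<open>P\<close> forceable in the remaining rounds. The number of
  remaining rounds can be read off from the length of the history.\<close>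

lemma strategy_if_forces:
  assumes "forces P t {} {}"
  obtains \<sigma> where "legal_builder \<sigma>"
    "\<And>\<pi>. \<exists>s\<le>t. P (red (play \<sigma> \<pi> s)) (blue (play \<sigma> \<pi> s))"
proof -
  define good where "good h e \<longleftrightarrow> card e = 2 \<and>
    (e \<notin> blue h \<longrightarrow> forces P (t - Suc (length h)) (insert e (red h)) (blue h)) \<and>
    (e \<notin> red h \<longrightarrow> forces P (t - Suc (length h)) (red h) (insert e (blue h)))" for h e
  define \<sigma> :: builder where
    "\<sigma> h = (if \<exists>e. good h e then SOME e. good h e else {0, 1})" for h
  have good_\<sigma>: "good h (\<sigma> h)" if "good h e" for h e
    using that by (auto simp: \<sigma>_def intro: someI)
  show thesis
  proof (rule that[of \<sigma>])
    show "legal_builder \<sigma>"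
      unfolding legal_builder_def
    proof
      fix h
      show "card (\<sigma> h) = 2"
      proof (cases "\<exists>e. good h e")
        case True
        then show ?thesis using good_\<sigma> by (auto simp: good_def)
      next
        case False
        then show ?thesis by (simp add: \<sigma>_def)
      qed
    qed
    fix \<pi>
    have "(\<exists>s'\<le>s. P (red (play \<sigma> \<pi> s')) (blue (play \<sigma> \<pi> s'))) \<or>
        forces P (t - s) (red (play \<sigma> \<pi> s)) (blue (play \<sigma> \<pi> s))" if "s \<le> t" for s
      using that
    proof (induction s)
      case 0
      then show ?case using assms by simp
    next
      case (Suc s)
      define h e where "h = play \<sigma> \<pi> s" and "e = \<sigma> h"
      show ?case
      proof (cases "\<exists>s'\<le>s. P (red (play \<sigma> \<pi> s')) (blue (play \<sigma> \<pi> s'))")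
        case True
        then show ?thesis using le_SucI by blast
      next
        case False
        then have "forces P (t - s) (red h) (blue h)" "\<not> P (red h) (blue h)"
          using Suc by (auto simp: h_def)
        moreover have "t - s = Suc (t - Suc (length h))"
          using Suc.prems by (simp add: h_def)
        ultimately obtain e' where "good h e'"
          by (auto simp: good_def elim: forces.cases)
        then have g: "good h e"
          unfolding e_def by (rule good_\<sigma>)
        obtain c where c: "play \<sigma> \<pi> (Suc s) = h @ [(e, c)]"
          "e \<in> red h \<union> blue h \<Longrightarrow> e \<in> edges_of_colour c h"
          unfolding h_def e_def using play_Suc_cases[of \<sigma> \<pi> s] by blast
        have disj: "red h \<inter> blue h = {}"
          unfolding h_def by (rule red_blue_disjoint)
        have "forces P (t - Suc s) (red (play \<sigma> \<pi> (Suc s))) (blue (play \<sigma> \<pi> (Suc s)))"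
          using g c(2) disj unfolding c(1) good_def
          by (cases c) (auto simp: h_def)
        then show ?thesis ..
      qed
    qed
    from this[of t] show "\<exists>s\<le>t. P (red (play \<sigma> \<pi> s)) (blue (play \<sigma> \<pi> s))"
      by (auto simp: forces_0_iff)
  qed
qed

lemma builder_can_win_iff_forces:
  "builder_can_win G H t \<longleftrightarrow> forces (\<lambda>R B. contains_copy R G \<or> contains_copy B H) t {} {}"
  (is "_ \<longleftrightarrow> forces ?P _ _ _")
proof
  assume "builder_can_win G H t"
  then obtain \<sigma> where "legal_builder \<sigma>" "\<And>\<pi>. \<exists>s\<le>t. ?P (red (play \<sigma> \<pi> s)) (blue (play \<sigma> \<pi> s))"
    unfolding builder_can_win_def by blast
  then show "forces ?P t {} {}"
    by (rule forces_if_strategy)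
next
  assume "forces ?P t {} {}"
  then obtain \<sigma> where "legal_builder \<sigma>" "\<And>\<pi>. \<exists>s\<le>t. ?P (red (play \<sigma> \<pi> s)) (blue (play \<sigma> \<pi> s))"
    by (rule strategy_if_forces) blast
  then show "builder_can_win G H t"
    unfolding builder_can_win_def by blast
qed

section \<open>Combining strategies\<close>

lemma contains_copy_mono: "contains_copy F G \<Longrightarrow> F \<subseteq> F' \<Longrightarrow> contains_copy F' G"
  unfolding contains_copy_def by blast

lemma contains_copy_relocated:
  assumes "inj \<phi>" "contains_copy F G"
  shows "contains_copy ((`) \<phi> ` F) G"
proof -
  obtain f where f: "inj_on f (fst G)" "\<forall>e\<in>snd G. f ` e \<in> F"
    using assms(2) unfolding contains_copy_def by blast
  have "inj_on (\<phi> \<circ> f) (fst G)"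
    using f(1) inj_on_subset[OF assms(1) subset_UNIV] by (rule comp_inj_on)
  moreover have "\<forall>e\<in>snd G. (\<phi> \<circ> f) ` e \<in> (`) \<phi> ` F"
    using f(2) by (simp flip: image_image add: comp_def)
  ultimately show ?thesis
    unfolding contains_copy_def by blast
qed

lemma forces_mono_rounds:
  assumes "forces P s R B" "s \<le> t"
  shows "forces P t R B"
  using assms
proof (induction arbitrary: t rule: forces.induct)
  case (reached R B s)
  then show ?case by (simp add: forces.reached)
next
  case (move e B s R)
  obtain t' where "t = Suc t'" "s \<le> t'"
    using move.prems by (cases t) auto
  then show ?case
    using move by (auto intro: forces.move)
qed

lemma forces_trans:
  assumes "forces P s R B" and "\<And>R B. P R B \<Longrightarrow> forces Q t R B"
  shows "forces Q (s + t) R B"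
  using assms(1)
proof (induction rule: forces.induct)
  case (reached R B s)
  then show ?case using assms(2) forces_mono_rounds by (metis le_add2)
next
  case (move e B s R)
  then show ?case by (auto intro: forces.move)
qed

text \<open>Builder can play a game on the vertices renamed by \<open>\<phi>\<close>, on top of any earlier
  position, because an edge coloured before only restricts Painter's answers.\<close>

lemma forces_relocated:
  assumes "inj \<phi>" "forces P t R B"
  shows "forces (\<lambda>R' B'. \<exists>R B. P R B \<and> R' = R0 \<union> (`) \<phi> ` R \<and> B' = B0 \<union> (`) \<phi> ` B)
    t (R0 \<union> (`) \<phi> ` R) (B0 \<union> (`) \<phi> ` B)"
  using assms(2)
proof (induction rule: forces.induct)
  case (reached R B t)
  then show ?case by (blast intro: forces.reached)
next
  case (move e B t R)
  show ?case
  proof (rule forces.move[of "\<phi> ` e"])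
    show "card (\<phi> ` e) = 2"
      using move.hyps(1) assms(1) by (simp add: card_image inj_on_subset)
  qed (use move.IH in auto)
qed

lemma forces_all_edges:
  assumes "finite E" "\<And>e. e \<in> E \<Longrightarrow> card e = 2"
  shows "forces (\<lambda>R' B'. R \<subseteq> R' \<and> B \<subseteq> B' \<and> E \<subseteq> R' \<union> B') (card E) R B"
  using assms
proof (induction E arbitrary: R B rule: finite_induct)
  case empty
  then show ?case by (auto intro: forces.reached)
next
  case (insert e E)
  let ?Q = "\<lambda>R' B'. R \<subseteq> R' \<and> B \<subseteq> B' \<and> insert e E \<subseteq> R' \<union> B'"
  have "forces ?Q (card E) R1 B1" if "R \<subseteq> R1" "B \<subseteq> B1" "e \<in> R1 \<union> B1" for R1 B1
  proof -
    have "forces ?Q (card E + 0) R1 B1"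
      by (rule forces_trans[OF insert.IH]) (use insert.prems that in \<open>auto intro!: forces.reached\<close>)
    then show ?thesis by simp
  qed
  note step = this
  have "forces ?Q (card E) (insert e R) B" "forces ?Q (card E) R (insert e B)"
    by (rule step; auto)+
  then have "forces ?Q (Suc (card E)) R B"
    using insert.prems by (intro forces.move[of e]) simp_all
  then show ?case
    using insert.hyps by simp
qed

section \<open>Red paths in complete bipartite graphs\<close>

text \<open>The path alternates between the two sides.\<close>

lemma path_in_complete_bipartite:
  assumes "finite X" "finite Y" "k \<le> card X" "k \<le> card Y" "X \<inter> Y = {}"
    and F: "\<And>x y. x \<in> X \<Longrightarrow> y \<in> Y \<Longrightarrow> {x, y} \<in> F"
  shows "contains_copy F (path_graph k)"
proof -
  obtain x where x: "inj_on x {..<k}" "x ` {..<k} \<subseteq> X"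
    using card_le_inj[of "{..<k}" X] assms by auto
  obtain y where y: "inj_on y {..<k}" "y ` {..<k} \<subseteq> Y"
    using card_le_inj[of "{..<k}" Y] assms by auto
  define f where "f i = (if even i then x i else y i)" for i
  have "inj_on f {..<k}"
  proof (rule inj_onI)
    fix i j assume ij: "i \<in> {..<k}" "j \<in> {..<k}" "f i = f j"
    have "x i \<in> X" "x j \<in> X" "y i \<in> Y" "y j \<in> Y"
      using ij x y by auto
    then show "i = j"
      using ij x(1) y(1) assms(5) by (auto simp: f_def dest: inj_onD split: if_splits)
  qed
  moreover have "{f i, f (Suc i)} \<in> F" if "Suc i < k" for i
  proof (cases "even i")
    case True
    moreover have "x i \<in> X" "y (Suc i) \<in> Y" using that x(2) y(2) by auto
    ultimately show ?thesis using F by (simp add: f_def)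
  next
    case False
    moreover have "x (Suc i) \<in> X" "y i \<in> Y" using that x(2) y(2) by auto
    ultimately show ?thesis using F[of "x (Suc i)" "y i"] by (simp add: f_def insert_commute)
  qed
  ultimately show ?thesis
    unfolding contains_copy_def path_graph_def by (intro exI[of _ f]) auto
qed

lemma blue_edge_between:
  assumes "\<not> contains_copy R (path_graph k)"
    and "finite X" "finite Y" "k \<le> card X" "k \<le> card Y" "X \<inter> Y = {}"
    and "\<And>x y. x \<in> X \<Longrightarrow> y \<in> Y \<Longrightarrow> {x, y} \<in> R \<union> B"
  obtains x y where "x \<in> X" "y \<in> Y" "{x, y} \<in> B"
  using path_in_complete_bipartite[of X Y k R] assms by blast

section \<open>Merging two blue cycles\<close>

definition is_path :: "nat set set \<Rightarrow> nat list \<Rightarrow> bool" where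
  "is_path F xs \<longleftrightarrow> distinct xs \<and> successively (\<lambda>u v. {u, v} \<in> F) xs"

lemma is_path_mono: "is_path F xs \<Longrightarrow> F \<subseteq> F' \<Longrightarrow> is_path F' xs"
  by (auto simp: is_path_def elim!: successively_mono)

lemma is_path_relocated:
  assumes "inj \<phi>" "is_path F xs"
  shows "is_path ((`) \<phi> ` F) (map \<phi> xs)"
proof -
  have "successively (\<lambda>u v. {\<phi> u, \<phi> v} \<in> (`) \<phi> ` F) xs"
    using assms(2) unfolding is_path_def by (auto elim!: successively_mono intro: rev_image_eqI)
  then show ?thesis
    using assms by (simp add: is_path_def distinct_map successively_map inj_on_subset[OF _ subset_UNIV])
qed

lemma is_path_append:
  assumes "is_path F xs" "is_path F ys" "set xs \<inter> set ys = {}" "xs \<noteq> []" "ys \<noteq> []"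
    "{last xs, hd ys} \<in> F"
  shows "is_path F (xs @ ys)"
  using assms by (auto simp: is_path_def successively_append_iff)

lemma cycle_if_closed_path:
  assumes path: "is_path F xs" and "xs \<noteq> []" "{last xs, hd xs} \<in> F"
  shows "contains_copy F (cycle_graph (length xs))"
proof -
  have "{xs ! i, xs ! (Suc i mod length xs)} \<in> F" if i: "i < length xs" for i
  proof (cases "Suc i = length xs")
    case True
    then have "xs ! i = last xs"
      using assms(2) by (simp add: last_conv_nth flip: True)
    then show ?thesis
      using assms True by (simp add: hd_conv_nth)
  next
    case False
    then have lt: "Suc i < length xs" using i by simp
    have "xs = take (Suc i) xs @ drop (Suc i) xs" by simp
    then have "successively (\<lambda>u v. {u, v} \<in> F) (take (Suc i) xs @ drop (Suc i) xs)"
      using path by (simp add: is_path_def)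
    then have "{last (take (Suc i) xs), hd (drop (Suc i) xs)} \<in> F"
      using lt unfolding successively_append_iff by (auto simp del: append_take_drop_id)
    then show ?thesis
      using lt by (simp add: hd_drop_conv_nth take_Suc_conv_app_nth)
  qed
  moreover have "inj_on ((!) xs) {..<length xs}"
    using path by (auto simp: is_path_def inj_on_def nth_eq_iff_index_eq)
  ultimately show ?thesis
    unfolding contains_copy_def cycle_graph_def by (intro exI[of _ "(!) xs"]) auto
qed

lemma path_if_cycle:
  assumes "contains_copy F (cycle_graph (Suc m))"
  obtains xs where "is_path F xs" "length xs = m"
proof -
  obtain f where f: "inj_on f {..<Suc m}"
    "\<forall>e\<in>{{i, Suc i mod Suc m} |i. i < Suc m}. f ` e \<in> F"
    using assms unfolding contains_copy_def cycle_graph_def fst_conv snd_conv by blast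
  have edge: "{f i, f (Suc i)} \<in> F" if "i < m" for i
  proof -
    have "f ` {i, Suc i mod Suc m} \<in> F"
      using that by (intro f(2)[rule_format]) auto
    then show ?thesis using that by simp
  qed
  have "successively (\<lambda>u v. {u, v} \<in> F) (map f [0..<j])" if "j \<le> m" for j
    using that
  proof (induction j)
    case (Suc j)
    then show ?case
      using edge[of "j - 1"] by (cases j) (auto simp: successively_append_iff)
  qed simp
  moreover have "inj_on f {0..<m}"
    using f(1) by (rule inj_on_subset) auto
  ultimately show thesis
    by (intro that[of "map f [0..<m]"]) (simp_all add: is_path_def distinct_map)
qed

text \<open>Connecting edges attach near the ends of a path, not exactly at the ends. What lies beyond
  them is cut off, which costs fewer than \<open>k\<close> vertices on either side.\<close>

lemma subpath_between_ends:
  assumes xs: "is_path F xs" "2 * k \<le> length xs"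
    and a: "a \<in> set (take k xs)" and b: "b \<in> set (drop (length xs - k) xs)"
  obtains ys where "is_path F ys" "ys \<noteq> []" "hd ys = a" "last ys = b" "set ys \<subseteq> set xs"
    "length ys \<le> length xs" "length xs \<le> length ys + 2 * k"
proof -
  obtain i where i: "i < k" "xs ! i = a"
    using a xs(2) by (auto simp: in_set_conv_nth)
  obtain l where l: "l < k" "drop (length xs - k) xs ! l = b"
    using b xs(2) by (auto simp: in_set_conv_nth)
  define j where "j = length xs - k + l"
  have j: "j < length xs" "xs ! j = b" "i \<le> j"
    using l i xs(2) by (auto simp: j_def)
  define ys where "ys = drop i (take (Suc j) xs)"
  have split: "xs = take i (take (Suc j) xs) @ ys @ drop (Suc j) xs"
    unfolding ys_def append_assoc[symmetric] append_take_drop_id ..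
  show thesis
  proof (rule that[of ys])
    show "is_path F ys"
      using xs(1) by (subst (asm) split) (auto simp: is_path_def successively_append_iff)
    show "ys \<noteq> []" "hd ys = a" "last ys = b"
      using i j by (auto simp: ys_def hd_drop_conv_nth last_conv_nth)
    show "set ys \<subseteq> set xs"
      by (subst split) auto
    show "length ys \<le> length xs" "length xs \<le> length ys + 2 * k"
      using j i by (auto simp: ys_def j_def)
  qed
qed

lemma is_path_if_clique:
  assumes "clique (set xs) F" "distinct xs"
  shows "is_path F xs"
  using assms
proof (induction xs)
  case (Cons x xs)
  then show ?case
    by (cases xs) (auto simp: is_path_def clique_def)
qed (simp add: is_path_def)

text \<open>The length of a path between two given vertices of a clique is free. This is what
  compensates for the vertices cut off from the two long paths.\<close>

lemma path_in_clique:
  assumes Q: "finite Q" "clique Q F" "a \<in> Q" "b \<in> Q" "a \<noteq> b" "2 \<le> s" "s \<le> card Q"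
  obtains qs where "is_path F qs" "qs \<noteq> []" "hd qs = a" "last qs = b" "set qs \<subseteq> Q" "length qs = s"
proof -
  have "s - 2 \<le> card (Q - {a, b})"
    using Q by (simp add: card_Diff_subset)
  then obtain S where S: "S \<subseteq> Q - {a, b}" "card S = s - 2" "finite S"
    by (meson obtain_subset_with_card_n)
  obtain ps where ps: "set ps = S" "distinct ps"
    using S(3) finite_distinct_list by blast
  show thesis
  proof (rule that[of "a # ps @ [b]"])
    show "is_path F (a # ps @ [b])"
      using Q S ps by (intro is_path_if_clique) (auto simp: clique_def)
    show "length (a # ps @ [b]) = s"
      using S(2) ps Q(6) distinct_card[OF ps(2)] by simp
  qed (use Q S ps in auto)
qed

definition path_ends :: "nat \<Rightarrow> nat list \<Rightarrow> nat set" where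
  "path_ends k xs = set (take k xs) \<union> set (drop (length xs - k) xs)"

text \<open>The blue cycle runs along the first path from \<open>a\<close> to \<open>u\<close>, crosses to \<open>v\<close>, runs along the second path
  to \<open>w\<close>, enters the clique at \<open>p\<close> and leaves it at \<open>q\<close> for \<open>a\<close>. The clique contributes at least the two
  vertices \<open>p\<close> and \<open>q\<close>, whence the summand \<open>2\<close> in the length; together with up to \<open>2 k\<close>
  vertices lost on each path this requires \<open>4 k + 2\<close> clique vertices.\<close>

lemma merge_paths:
  assumes no_red: "\<not> contains_copy R (path_graph k)"
    and xs: "is_path B xs" "2 * k \<le> length xs" and ys: "is_path B ys" "2 * k \<le> length ys"
    and Q: "finite Q" "card Q = 4 * k + 2" "clique Q B"
    and disjoint: "set xs \<inter> set ys = {}" "Q \<inter> (set xs \<union> set ys) = {}"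
    and coloured: "\<And>u v. u \<in> Q \<union> path_ends k xs \<union> path_ends k ys \<Longrightarrow>
      v \<in> Q \<union> path_ends k xs \<union> path_ends k ys \<Longrightarrow> u \<noteq> v \<Longrightarrow> {u, v} \<in> R \<union> B"
  shows "contains_copy B (cycle_graph (length xs + length ys + 2))"
proof -
  have card_start: "card (set (take k zs)) = k" and card_end: "card (set (drop (length zs - k) zs)) = k"
    if "is_path B zs" "2 * k \<le> length zs" for zs
    using that by (auto simp: is_path_def distinct_card)
  have sub: "set (take k zs) \<subseteq> set zs" "set (drop (length zs - k) zs) \<subseteq> set zs" for zs :: "nat list"
    by (auto dest: in_set_takeD in_set_dropD)
  have join: "\<exists>u v. u \<in> X \<and> v \<in> Y \<and> {u, v} \<in> B"
    if "X \<subseteq> Q \<union> path_ends k xs \<union> path_ends k ys" "Y \<subseteq> Q \<union> path_ends k xs \<union> path_ends k ys"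
      "X \<inter> Y = {}" "k \<le> card X" "k \<le> card Y" for X Y
  proof -
    have "finite (Q \<union> path_ends k xs \<union> path_ends k ys)"
      using Q(1) by (simp add: path_ends_def)
    then have fin: "finite X" "finite Y"
      using that finite_subset by blast+
    have "{x, y} \<in> R \<union> B" if "x \<in> X" "y \<in> Y" for x y
      using that \<open>X \<subseteq> _\<close> \<open>Y \<subseteq> _\<close> \<open>X \<inter> Y = {}\<close> by (intro coloured) auto
    then show ?thesis
      using blue_edge_between[OF no_red fin \<open>k \<le> card X\<close> \<open>k \<le> card Y\<close> \<open>X \<inter> Y = {}\<close>] by metis
  qed
  obtain u v where uv: "u \<in> set (drop (length xs - k) xs)" "v \<in> set (take k ys)" "{u, v} \<in> B"
    using join[of "set (drop (length xs - k) xs)" "set (take k ys)"]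
      card_end[OF xs] card_start[OF ys] sub disjoint(1) by (force simp: path_ends_def)
  obtain w p where wp: "w \<in> set (drop (length ys - k) ys)" "p \<in> Q" "{w, p} \<in> B"
    using join[of "set (drop (length ys - k) ys)" Q] card_end[OF ys] Q(2) sub disjoint(2)
    by (force simp: path_ends_def)
  have "card (Q - {p}) = 4 * k + 1"
    using Q(1,2) wp(2) by simp
  then obtain q a where qa: "q \<in> Q - {p}" "a \<in> set (take k xs)" "{q, a} \<in> B"
    using join[of "Q - {p}" "set (take k xs)"] card_start[OF xs] sub disjoint(2)
    by (force simp: path_ends_def)
  obtain xs' where xs': "is_path B xs'" "xs' \<noteq> []" "hd xs' = a" "last xs' = u" "set xs' \<subseteq> set xs"
    "length xs' \<le> length xs" "length xs \<le> length xs' + 2 * k"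
    using subpath_between_ends[OF xs qa(2) uv(1)] .
  obtain ys' where ys': "is_path B ys'" "ys' \<noteq> []" "hd ys' = v" "last ys' = w" "set ys' \<subseteq> set ys"
    "length ys' \<le> length ys" "length ys \<le> length ys' + 2 * k"
    using subpath_between_ends[OF ys uv(2) wp(1)] .
  define s where "s = length xs + length ys + 2 - length xs' - length ys'"
  have s: "2 \<le> s" "s \<le> card Q"
    using xs'(6,7) ys'(6,7) Q(2) by (auto simp: s_def)
  obtain qs where qs: "is_path B qs" "qs \<noteq> []" "hd qs = p" "last qs = q" "set qs \<subseteq> Q" "length qs = s"
    by (rule path_in_clique[OF Q(1,3) wp(2) _ _ s, of q]) (use qa in auto)
  have "is_path B (ys' @ qs)"
    by (rule is_path_append[OF ys'(1) qs(1)]) (use ys' qs wp disjoint in auto)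
  then have "is_path B (xs' @ ys' @ qs)"
    by (rule is_path_append[OF xs'(1)]) (use xs' ys' qs uv disjoint in auto)
  then have "contains_copy B (cycle_graph (length (xs' @ ys' @ qs)))"
    using xs' ys' qs qa by (intro cycle_if_closed_path) auto
  moreover have "length (xs' @ ys' @ qs) = length xs + length ys + 2"
    using xs'(6) ys'(6) qs(6) by (simp add: s_def)
  ultimately show ?thesis by simp
qed

section \<open>Subadditivity\<close>

text \<open>The merging takes a number of rounds that depends only on \<open>k\<close> and the Ramsey number \<open>N\<close>: Builder
  chooses all pairs from a set of at most \<open>N + 4 k\<close> vertices, and \<open>2 ^ (N + 4 k)\<close> bounds the number
  of these pairs.\<close>

lemma forces_merged_cycle:
  fixes R B :: "nat set set"
  assumes ramsey: "\<forall>(V :: nat set) E. finite V \<and> card V \<ge> N \<longrightarrow>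
      (\<exists>Q\<subseteq>V. card Q = k \<and> clique Q E \<or> card Q = 4 * k + 2 \<and> indep Q E)"
    and xs: "is_path B xs" "2 * k \<le> length xs" and ys: "is_path B ys" "2 * k \<le> length ys"
    and disj: "set xs \<inter> set ys = {}"
  shows "forces (\<lambda>R B. contains_copy R (path_graph k) \<or>
    contains_copy B (cycle_graph (length xs + length ys + 2))) (2 ^ (N + 4 * k)) R B"
    (is "forces ?win _ _ _")
proof -
  obtain W where W: "finite W" "card W = N" "W \<inter> (set xs \<union> set ys) = {}"
  proof -
    have "infinite (- (set xs \<union> set ys))"
      by (simp add: Compl_eq_Diff_UNIV)
    then obtain W where "finite W" "card W = N" "W \<subseteq> - (set xs \<union> set ys)"
      using infinite_arbitrarily_large by blast
    then show thesis by (intro that) auto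
  qed
  define T where "T = W \<union> path_ends k xs \<union> path_ends k ys"
  define E where "E = {e. e \<subseteq> T \<and> card e = 2}"
  have card_ends: "card (path_ends k zs) \<le> 2 * k" for zs
  proof -
    have "card (set (take k zs)) \<le> k" "card (set (drop (length zs - k) zs)) \<le> k"
      by (rule order.trans[OF card_length], simp)+
    then show ?thesis
      using card_Un_le[of "set (take k zs)" "set (drop (length zs - k) zs)"]
      unfolding path_ends_def by linarith
  qed
  have "finite T"
    using W(1) by (simp add: T_def path_ends_def)
  have "card T \<le> N + 4 * k"
    using card_Un_le[of "W \<union> path_ends k xs" "path_ends k ys"] card_Un_le[of W "path_ends k xs"]
      card_ends[of xs] card_ends[of ys] W(2) unfolding T_def by linarith
  have "card E \<le> card (Pow T)"
    using \<open>finite T\<close> by (intro card_mono) (auto simp: E_def)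
  also have "\<dots> \<le> 2 ^ (N + 4 * k)"
    using \<open>card T \<le> _\<close> by (simp add: card_Pow \<open>finite T\<close>)
  finally have card_E: "card E \<le> 2 ^ (N + 4 * k)" .
  have "finite E"
    using \<open>finite T\<close> by (auto simp: E_def)
  have final: "?win R' B'" if "R \<subseteq> R' \<and> B \<subseteq> B' \<and> E \<subseteq> R' \<union> B'" for R' B'
  proof (subst disj_imp, rule impI)
    assume no_red: "\<not> contains_copy R' (path_graph k)"
    have coloured: "{u, v} \<in> R' \<union> B'" if "u \<in> T" "v \<in> T" "u \<noteq> v" for u v
    proof -
      have "{u, v} \<in> E" using that by (simp add: E_def)
      then show ?thesis using \<open>R \<subseteq> R' \<and> _\<close> by blast
    qed
    obtain Q where Q: "Q \<subseteq> W" "card Q = k \<and> clique Q R' \<or> card Q = 4 * k + 2 \<and> indep Q R'"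
      using ramsey W by blast
    have finQ: "finite Q"
      using Q(1) W(1) finite_subset by blast
    have "\<not> (card Q = k \<and> clique Q R')"
    proof
      assume *: "card Q = k \<and> clique Q R'"
      have "contains_copy R' (path_graph k)"
        by (rule contains_copy_complete[OF finite_graph_path finQ])
          (use * in \<open>auto simp: path_graph_def clique_def\<close>)
      then show False using no_red by simp
    qed
    then have Q': "card Q = 4 * k + 2" "indep Q R'"
      using Q(2) by blast+
    have "clique Q B'"
      unfolding clique_def
    proof (intro ballI impI)
      fix u v assume uv: "u \<in> Q" "v \<in> Q" "u \<noteq> v"
      then have "{u, v} \<in> R' \<union> B'"
        using Q(1) by (intro coloured) (auto simp: T_def)
      then show "{u, v} \<in> B'"
        using Q'(2) uv by (auto simp: indep_def)
    qed
    have path_mono: "is_path B' zs" if "is_path B zs" for zs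
      using is_path_mono that \<open>R \<subseteq> R' \<and> _\<close> by blast
    show "contains_copy B' (cycle_graph (length xs + length ys + 2))"
    proof (rule merge_paths[OF no_red path_mono[OF xs(1)] _ path_mono[OF ys(1)] _ finQ Q'(1) \<open>clique Q B'\<close> disj])
      show "{u, v} \<in> R' \<union> B'"
        if "u \<in> Q \<union> path_ends k xs \<union> path_ends k ys" "v \<in> Q \<union> path_ends k xs \<union> path_ends k ys" "u \<noteq> v"
        for u v
        using that Q(1) by (intro coloured) (auto simp: T_def)
    qed (use xs(2) ys(2) disj W Q in auto)
  qed
  have "forces ?win (card E + 0) R B"
    by (rule forces_trans[OF forces_all_edges[OF \<open>finite E\<close>]])
      (use final in \<open>auto simp: E_def intro: forces.reached\<close>)
  then show ?thesis
    using card_E forces_mono_rounds by simp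
qed

text \<open>Removing a vertex from each cycle leaves paths with \<open>m\<close> and \<open>n\<close> vertices, and the two
  vertices that a merged cycle spends at least in the clique replace the removed ones.\<close>

lemma win_merged_cycle:
  assumes ramsey: "\<forall>(V :: nat set) E. finite V \<and> card V \<ge> N \<longrightarrow>
      (\<exists>Q\<subseteq>V. card Q = k \<and> clique Q E \<or> card Q = 4 * k + 2 \<and> indep Q E)"
    and m: "2 * k \<le> m" "builder_can_win (path_graph k) (cycle_graph (Suc m)) s"
    and n: "2 * k \<le> n" "builder_can_win (path_graph k) (cycle_graph (Suc n)) t"
  shows "builder_can_win (path_graph k) (cycle_graph (Suc m + Suc n)) (s + (t + 2 ^ (N + 4 * k)))"
proof -
  let ?win = "\<lambda>l R B. contains_copy R (path_graph k) \<or> contains_copy B (cycle_graph l)"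
  have second: "forces (?win (Suc m + Suc n)) (t + 2 ^ (N + 4 * k)) R B"
    if win_m: "?win (Suc m) R B" for R B
  proof (cases "contains_copy R (path_graph k)")
    case True
    then show ?thesis by (simp add: forces.reached)
  next
    case False
    then obtain xs where xs: "is_path B xs" "length xs = m"
      using win_m path_if_cycle by blast
    \<comment> \<open>The second game is played on the vertices beyond all those of \<open>xs\<close>.\<close>
    define d where "d = Suc (Max (insert 0 (set xs)))"
    have d: "x < d" if "x \<in> set xs" for x
      using that by (simp add: d_def less_Suc_eq_le)
    define \<phi> where "\<phi> x = d + x" for x :: nat
    have "inj \<phi>"
      by (auto simp: \<phi>_def inj_def)
    let ?P = "\<lambda>R' B'. \<exists>R1 B1. ?win (Suc n) R1 B1 \<and> R' = R \<union> (`) \<phi> ` R1 \<and> B' = B \<union> (`) \<phi> ` B1"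
    have "forces ?P t R B"
      using forces_relocated[OF \<open>inj \<phi>\<close> n(2)[unfolded builder_can_win_iff_forces], of R B] by simp
    then show ?thesis
    proof (rule forces_trans)
      fix R' B' assume "?P R' B'"
      then obtain R1 B1 where R1B1: "?win (Suc n) R1 B1"
        "R' = R \<union> (`) \<phi> ` R1" "B' = B \<union> (`) \<phi> ` B1"
        by blast
      show "forces (?win (Suc m + Suc n)) (2 ^ (N + 4 * k)) R' B'"
      proof (cases "contains_copy R1 (path_graph k)")
        case True
        then have "contains_copy R' (path_graph k)"
          using contains_copy_mono[OF contains_copy_relocated[OF \<open>inj \<phi>\<close> True]] R1B1(2) by simp
        then show ?thesis by (simp add: forces.reached)
      next
        case False
        then obtain ys where ys: "is_path B1 ys" "length ys = n"
          using R1B1(1) path_if_cycle by blast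
        have "is_path B' xs" "is_path B' (map \<phi> ys)"
          using is_path_mono[OF xs(1)] is_path_mono[OF is_path_relocated[OF \<open>inj \<phi>\<close> ys(1)]] R1B1(3)
          by simp_all
        moreover have "set xs \<inter> set (map \<phi> ys) = {}"
          using d by (fastforce simp: \<phi>_def)
        ultimately show ?thesis
          using forces_merged_cycle[OF ramsey, of B' xs "map \<phi> ys" R'] xs(2) ys(2) m(1) n(1)
          by simp
      qed
    qed
  qed
  show ?thesis
    unfolding builder_can_win_iff_forces
    by (rule forces_trans[OF m(2)[unfolded builder_can_win_iff_forces] second])
qed

lemma online_ramsey_wins:
  assumes "finite_graph G" "finite_graph H"
  shows "builder_can_win G H (online_ramsey G H)"
  unfolding online_ramsey_def using builder_can_win_exists[OF assms] by (rule LeastI_ex)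

lemma online_ramsey_path_cycle_subadditive:
  obtains C where "\<And>m n. 2 * k + 3 \<le> m \<Longrightarrow> 2 * k + 3 \<le> n \<Longrightarrow>
    online_ramsey (path_graph k) (cycle_graph (m + n)) \<le>
      online_ramsey (path_graph k) (cycle_graph m) + online_ramsey (path_graph k) (cycle_graph n) + C"
proof -
  obtain N where N: "\<forall>(V :: nat set) E. finite V \<and> card V \<ge> N \<longrightarrow>
      (\<exists>Q\<subseteq>V. card Q = k \<and> clique Q E \<or> card Q = 4 * k + 2 \<and> indep Q E)"
    using ramsey2[of k "4 * k + 2"] by blast
  let ?r = "\<lambda>n. online_ramsey (path_graph k) (cycle_graph n)"
  show thesis
  proof (rule that)
    fix m n assume mn: "2 * k + 3 \<le> m" "2 * k + 3 \<le> n"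
    have wins: "builder_can_win (path_graph k) (cycle_graph l) (?r l)" if "3 \<le> l" for l
      using that by (intro online_ramsey_wins finite_graph_path finite_graph_cycle)
    obtain m' n' where "m = Suc m'" "n = Suc n'"
      using mn by (cases m; cases n) auto
    then have "builder_can_win (path_graph k) (cycle_graph (m + n)) (?r m + (?r n + 2 ^ (N + 4 * k)))"
      using win_merged_cycle[OF N, of m' "?r m" n' "?r n"] wins mn by simp
    then have "?r (m + n) \<le> ?r m + (?r n + 2 ^ (N + 4 * k))"
      unfolding online_ramsey_def[of _ "cycle_graph (m + n)"] by (rule Least_le)
    then show "?r (m + n) \<le> ?r m + ?r n + 2 ^ (N + 4 * k)"
      by simp
  qed
qed

section \<open>Fekete's lemma\<close>

text \<open>The remainder \<open>r\<close> is kept at \<open>n0\<close> or above, where subadditivity is known.\<close>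

lemma subadditive_multiple:
  fixes f :: "nat \<Rightarrow> real"
  assumes sub: "\<And>m n. n0 \<le> m \<Longrightarrow> n0 \<le> n \<Longrightarrow> f (m + n) \<le> f m + f n"
    and "n0 \<le> n" "n0 \<le> r"
  shows "f (q * n + r) \<le> real q * f n + f r"
proof (induction q)
  case (Suc q)
  have "f (n + (q * n + r)) \<le> f n + f (q * n + r)"
    using assms by (intro sub) auto
  then show ?case
    using Suc by (simp add: algebra_simps)
qed simp

text \<open>Fix \<open>n\<close> with \<open>f n / n\<close> close to the infimum. Splitting \<open>N\<close> into copies of \<open>n\<close> and a remainder
  from \<open>{n0..<n0 + n}\<close> bounds \<open>f N / N\<close> by \<open>f n / n\<close> up to an error of order \<open>1 / N\<close>.\<close>

lemma fekete:
  fixes f :: "nat \<Rightarrow> real"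
  assumes sub: "\<And>m n. n0 \<le> m \<Longrightarrow> n0 \<le> n \<Longrightarrow> f (m + n) \<le> f m + f n"
    and nonneg: "\<And>n. 0 \<le> f n" and "1 \<le> n0"
  shows "(\<lambda>n. f n / real n) \<longlonglongrightarrow> (INF n\<in>{n0..}. f n / real n)" (is "_ \<longlonglongrightarrow> ?L")
proof (rule LIMSEQ_I)
  fix e :: real assume "0 < e"
  have bdd: "bdd_below ((\<lambda>n. f n / real n) ` {n0..})"
    using nonneg by (intro bdd_belowI2[of _ 0]) auto
  obtain n where n: "n0 \<le> n" "f n / real n < ?L + e / 2"
    using cINF_less_iff[OF _ bdd, of "?L + e / 2"] \<open>0 < e\<close> by auto
  define M where "M = Max (f ` {..<n + n0})"
  have M: "f r \<le> M" if "r < n + n0" for r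
    using that by (simp add: M_def)
  have "0 < n" using n(1) \<open>1 \<le> n0\<close> by simp
  obtain N1 :: nat where N1: "2 * M / e < real N1"
    using reals_Archimedean2 by blast
  show "\<exists>N0. \<forall>N\<ge>N0. norm (f N / real N - ?L) < e"
  proof (intro exI allI impI)
    fix N assume "max n0 N1 \<le> N"
    then have N: "n0 \<le> N" "N1 \<le> N" by auto
    have "0 < N" using N(1) \<open>1 \<le> n0\<close> by simp
    define q r where "q = (N - n0) div n" and "r = n0 + (N - n0) mod n"
    have Nqr: "N = q * n + r"
      using N(1) div_mult_mod_eq[of "N - n0" n] unfolding q_def r_def by linarith
    have r: "n0 \<le> r" "r < n + n0"
      using \<open>0 < n\<close> by (auto simp: r_def)
    have "f N \<le> real q * f n + M"
      using subadditive_multiple[OF sub n(1) r(1), of q] M[OF r(2)] Nqr by simp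
    also have "real q * f n = real (q * n) * (f n / real n)"
      using \<open>0 < n\<close> by simp
    also have "\<dots> \<le> real N * (f n / real n)"
      using nonneg[of n] Nqr by (intro mult_right_mono) auto
    finally have "f N / real N \<le> f n / real n + M / real N"
      using \<open>0 < N\<close> by (simp add: field_simps)
    moreover have "M / real N < e / 2"
    proof -
      have "2 * M / e < real N" using N1 N(2) by linarith
      then show ?thesis using \<open>0 < e\<close> \<open>0 < N\<close> by (simp add: field_simps)
    qed
    moreover have "?L \<le> f N / real N"
      using bdd N(1) by (intro cINF_lower) auto
    ultimately show "norm (f N / real N - ?L) < e"
      unfolding real_norm_def using n(2) by linarith
  qed
qed

theorem theorem1p2:
  fixes k :: nat
  assumes "k \<ge> 1"
  shows "\<exists>L :: real.
    (\<lambda>n. real (online_ramsey (path_graph k) (cycle_graph n)) / real n) \<longlonglongrightarrow> L"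
proof -
  let ?r = "\<lambda>n. online_ramsey (path_graph k) (cycle_graph n)"
  obtain C where C: "\<And>m n. 2 * k + 3 \<le> m \<Longrightarrow> 2 * k + 3 \<le> n \<Longrightarrow> ?r (m + n) \<le> ?r m + ?r n + C"
    using online_ramsey_path_cycle_subadditive[of k] by blast
  define f where "f n = real (?r n) + real C" for n
  have "f (m + n) \<le> f m + f n" if "2 * k + 3 \<le> m" "2 * k + 3 \<le> n" for m n
    using C[OF that] by (simp add: f_def flip: of_nat_add)
  then have "(\<lambda>n. f n / real n) \<longlonglongrightarrow> (INF n\<in>{2 * k + 3..}. f n / real n)"
    by (rule fekete) (auto simp: f_def)
  then have "(\<lambda>n. f n / real n - real C / real n) \<longlonglongrightarrow> (INF n\<in>{2 * k + 3..}. f n / real n) - 0"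
    by (intro tendsto_diff lim_const_over_n)
  then show ?thesis
    by (auto simp: f_def diff_divide_distrib[symmetric])
qed

end
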